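(* The following strong $\mathfrak S$-Wilf-equivalences hold (write $\sim_*$ for $\overset{\mathfrak S}{\sim_*}$): (a) $124-3\sim_* 421-3$; (b) $2-14-3\sim_* 2-41-3$; (c) $13-24\sim_* 24-13$.
   Context: $\mathfrak S=\bigsqcup_{n\ge0}\mathfrak S_n$ is the collection of all permutations, where $\mathfrak S_n$ is the symmetric group on $\{1,\ldots,n\}$, whose elements $\sigma$ are viewed as words $\sigma(1)\sigma(2)\cdots\sigma(n)$. A dashed pattern $p$ of length $m$ is a word $p_1\cdots p_m$ whose set of letters is exactly $\{1,\dots,r\}$ for some $r\geq1$, in which two adjacent letters may or may not be separated by a dash. An occurrence of $p$ in a word $w=w_1\cdots w_n$ of positive integers is a choice of positions $1\le i_1<\dots<i_m\le n$ such that $w_{i_s}>w_{i_t}$ if and only if $p_s>p_t$ for all $s,t$, and $i_{s+1}=i_s+1$ whenever $p_s$ and $p_{s+1}$ are not separated by a dash. In the patterns listed, each digit is a letter (e.g. $124-3$ has letters $1,2,4,3$ with a dash only between $4$ and $3$). Two patterns $p,q$ are strongly $\mathfrak S$-Wilf-equivalent, written $p\overset{\mathfrak S}{\sim_*}q$, if for all $n,k\ge0$ the number of permutations in $\mathfrak S_n$ with exactly $k$ occurrences of $p$ equals the number with exactly $k$ occurrences of $q$. *)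

theory Defs
  imports "HOL-Combinatorics.Permutations"
begin

text \<open>
  \<open>dashes\<close> contains \<open>j\<close> iff there is a dash between the \<open>j\<close>-th and the \<open>(j + 1)\<close>-th letter,
  letters being numbered from 1. For example \<open>2-14-3\<close> is \<open>DP [2,1,4,3] {1,3}\<close>.
\<close>
datatype dashed_pattern = DP (letters: "nat list") (dashes: "nat set")

definition is_dashed_pattern :: "dashed_pattern \<Rightarrow> bool" where
  "is_dashed_pattern p \<longleftrightarrow>
     (\<exists>r\<ge>1. set (letters p) = {1..r}) \<and> dashes p \<subseteq> {1..<length (letters p)}"

text \<open>
  Positions, like list indices, are counted from 0 here, so the letters with list indices
  \<open>s\<close> and \<open>Suc s\<close> are separated by a dash iff \<open>Suc s \<in> dashes p\<close>.
\<close>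
definition is_occurrence :: "dashed_pattern \<Rightarrow> nat list \<Rightarrow> nat list \<Rightarrow> bool" where
  "is_occurrence p w i \<longleftrightarrow>
     length i = length (letters p) \<and> sorted_wrt (<) i \<and> set i \<subseteq> {..<length w} \<and>
     (\<forall>s<length i. \<forall>t<length i. w ! (i ! s) > w ! (i ! t) \<longleftrightarrow> letters p ! s > letters p ! t) \<and>
     (\<forall>s. Suc s < length i \<longrightarrow> Suc s \<notin> dashes p \<longrightarrow> i ! Suc s = Suc (i ! s))"

definition occurrences :: "dashed_pattern \<Rightarrow> nat list \<Rightarrow> nat" where
  "occurrences p w = card {i. is_occurrence p w i}"

definition perm_word :: "nat \<Rightarrow> (nat \<Rightarrow> nat) \<Rightarrow> nat list" where
  "perm_word n \<sigma> = map \<sigma> [1..<Suc n]"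

definition strongly_wilf_equiv :: "dashed_pattern \<Rightarrow> dashed_pattern \<Rightarrow> bool"
    (infix "\<sim>\<^sub>*" 50) where
  "p \<sim>\<^sub>* q \<longleftrightarrow> is_dashed_pattern p \<and> is_dashed_pattern q \<and>
     (\<forall>n k. card {\<sigma>. \<sigma> permutes {1..n} \<and> occurrences p (perm_word n \<sigma>) = k} =
            card {\<sigma>. \<sigma> permutes {1..n} \<and> occurrences q (perm_word n \<sigma>) = k})"

end

(* Replace a word by the linear order R in which its letters appear, and an occurrence by the
   quadruple a < b < c < d of its letters. In each of the three cases the first pattern asks that
   certain pairs be adjacent ascents and that certain letters precede others, and the second
   pattern (up to reversing the whole word, in case (c)) asks the same with adjacent descents.
   Since sum_R binomial(occ R, j) counts words with j marked occurrences, it suffices to show that,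
   for each fixed set S of quadruples, as many words contain all of S as occurrences of the first
   pattern as of the second. The adjacencies imposed by S glue letters into increasing runs; reversing
   every run in place turns the ascents into descents. It keeps the imposed precedences because each
   of them compares x with a letter strictly between x and the right neighbour of x, and such a
   letter does not lie in the run of x. *)
theory Submission
  imports Defs
begin

section \<open>Distributions determined by binomial sums\<close>

text \<open>The binomial sums depend on the level counts through a triangular system with ones on
  the diagonal, which can be solved from the largest value downwards.\<close>

lemma card_eq_if_binomial_sums_eq:
  fixes f :: "'a \<Rightarrow> nat" and g :: "'b \<Rightarrow> nat"
  assumes fin: "finite X" "finite Y"
    and eq: "\<And>j. (\<Sum>x\<in>X. f x choose j) = (\<Sum>y\<in>Y. g y choose j)"
  shows "card {x \<in> X. f x = k} = card {y \<in> Y. g y = k}"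
proof -
  \<comment> \<open>Grouping by the value \<open>m\<close> of \<open>h\<close>, levels
    \<open>m < j\<close> contribute nothing and level \<open>m = j\<close> has coefficient
    1.\<close>
  have expand: "(\<Sum>x\<in>Z. h x choose j) = card {x \<in> Z. h x = j} +
      (\<Sum>m\<in>{j<..K}. card {x \<in> Z. h x = m} * (m choose j))"
    if Z: "finite Z" and K: "\<And>x. x \<in> Z \<Longrightarrow> h x \<le> K" and j: "j \<le> K"
    for Z :: "'c set" and h j K
  proof -
    have "(\<Sum>x\<in>Z. h x choose j) = (\<Sum>m\<le>K. \<Sum>x\<in>{x \<in> Z. h x = m}. h x choose j)"
      using K by (intro sum.group[symmetric] Z finite_atMost) auto
    also have "\<dots> = (\<Sum>m\<le>K. card {x \<in> Z. h x = m} * (m choose j))"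
      by (intro sum.cong) auto
    also have "\<dots> = (\<Sum>m\<in>{j..K}. card {x \<in> Z. h x = m} * (m choose j))"
      by (intro sum.mono_neutral_right) auto
    also have "{j..K} = insert j {j<..K}"
      using j by auto
    finally show ?thesis
      by simp
  qed
  \<comment> \<open>Inserting \<open>k\<close> keeps the maximum meaningful for empty
    \<open>X\<close> and \<open>Y\<close> and gives \<open>k \<le> K\<close>, where the downward
    induction starts.\<close>
  define K where "K = Max (insert k (f ` X \<union> g ` Y))"
  have K: "k \<le> K" "\<And>x. x \<in> X \<Longrightarrow> f x \<le> K" "\<And>y. y \<in> Y \<Longrightarrow> g y \<le> K"
    unfolding K_def using fin by (auto intro!: Max_ge)
  show ?thesis
    using K(1)
  proof (induction "K - k" arbitrary: k rule: less_induct)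
    case less
    have "(\<Sum>m\<in>{k<..K}. card {x \<in> X. f x = m} * (m choose k)) =
        (\<Sum>m\<in>{k<..K}. card {y \<in> Y. g y = m} * (m choose k))"
      using less by (intro sum.cong) auto
    then show ?case
      using expand[of X f K k] expand[of Y g K k] eq[of k] K fin less.prems by simp
  qed
qed

text \<open>Double counting of the pairs \<open>(x, S)\<close> with \<open>S\<close> a
  \<open>j\<close>-element subset of \<open>F x\<close>.\<close>

lemma sum_card_choose:
  assumes fin: "finite X" "finite U" and sub: "\<And>x. x \<in> X \<Longrightarrow> F x \<subseteq> U"
  shows "(\<Sum>x\<in>X. card (F x) choose j) = (\<Sum>S | S \<subseteq> U \<and> card S = j. card {x \<in> X. S \<subseteq> F x})"
proof -
  let ?C = "{S. S \<subseteq> U \<and> card S = j}"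
  have fC: "finite ?C"
    using fin by simp
  have "(\<Sum>x\<in>X. card (F x) choose j) = (\<Sum>x\<in>X. card {S \<in> ?C. S \<subseteq> F x})"
  proof (intro sum.cong refl)
    fix x assume x: "x \<in> X"
    have "{S \<in> ?C. S \<subseteq> F x} = {S. S \<subseteq> F x \<and> card S = j}"
      using sub[OF x] by auto
    then show "card (F x) choose j = card {S \<in> ?C. S \<subseteq> F x}"
      using n_subsets[of "F x" j] finite_subset[OF sub[OF x] fin(2)] by simp
  qed
  also have "\<dots> = (\<Sum>S\<in>?C. card {x \<in> X. S \<subseteq> F x})"
    by (rule sum_multicount_gen[OF fin(1) fC]) simp
  finally show ?thesis .
qed

lemma card_eq_if_marked_card_eq:
  assumes fin: "finite X" "finite U"
    and sub: "\<And>x. x \<in> X \<Longrightarrow> F x \<subseteq> U" "\<And>x. x \<in> X \<Longrightarrow> G x \<subseteq> U"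
    and eq: "\<And>S. S \<subseteq> U \<Longrightarrow> card {x \<in> X. S \<subseteq> F x} = card {x \<in> X. S \<subseteq> G x}"
  shows "card {x \<in> X. card (F x) = k} = card {x \<in> X. card (G x) = k}"
proof (rule card_eq_if_binomial_sums_eq[OF fin(1) fin(1)])
  fix j
  show "(\<Sum>x\<in>X. card (F x) choose j) = (\<Sum>x\<in>X. card (G x) choose j)"
    using eq by (simp add: sum_card_choose[OF fin sub(1)] sum_card_choose[OF fin sub(2)])
qed

section \<open>Linear orders and adjacency\<close>

text \<open>Confining \<open>R\<close> to \<open>A \<times> A\<close> leaves exactly one relation
  per arrangement of a finite \<open>A\<close>.\<close>

definition linear_orders :: "'a set \<Rightarrow> 'a rel set" where
  "linear_orders A = {R. R \<subseteq> A \<times> A \<and> strict_linear_order_on A R}"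

text \<open>When \<open>R\<close> is the order of appearance in a word, this is the relation
  "immediately followed by".\<close>

definition cover :: "'a rel \<Rightarrow> 'a rel" where
  "cover R = R - R O R"

lemma finite_linear_orders: "finite A \<Longrightarrow> finite (linear_orders A)"
  unfolding linear_orders_def by (rule finite_subset[of _ "Pow (A \<times> A)"]) auto

lemma linear_ordersD:
  assumes "R \<in> linear_orders A"
  shows "R \<subseteq> A \<times> A" "trans R" "\<And>x. (x, x) \<notin> R"
    "\<And>x y. x \<in> A \<Longrightarrow> y \<in> A \<Longrightarrow> x \<noteq> y \<Longrightarrow> (x, y) \<in> R \<or> (y, x) \<in> R"
  using assms unfolding linear_orders_def strict_linear_order_on_def irrefl_def total_on_def by auto

lemma cover_converse: "cover (R\<inverse>) = (cover R)\<inverse>"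
  unfolding cover_def by auto

lemma converse_linear_orders: "R \<in> linear_orders A \<Longrightarrow> R\<inverse> \<in> linear_orders A"
  unfolding linear_orders_def strict_linear_order_on_def by auto

lemma single_valued_cover:
  assumes "R \<in> linear_orders A"
  shows "single_valued (cover R)"
  using linear_ordersD[OF assms] unfolding single_valued_def cover_def by blast

section \<open>Reversing intervals in place\<close>

text \<open>When the classes of \<open>E\<close> are intervals of \<open>R\<close>, this reads every
  such block of the word backwards without moving it.\<close>

definition reverse_classes :: "'a rel \<Rightarrow> 'a rel \<Rightarrow> 'a rel" where
  "reverse_classes E R = (R - E) \<union> (R\<inverse> \<inter> E)"

lemma reverse_classes_invol:
  assumes "sym E"
  shows "reverse_classes E (reverse_classes E R) = R"
  using assms unfolding reverse_classes_def sym_def by auto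

text \<open>The classes are intervals: a step within a class of elements below \<open>y\<close> moves to a
  neighbour, so it cannot jump over \<open>y\<close>.\<close>
lemma linked_classes_convex:
  assumes R: "R \<in> linear_orders A" and L: "L \<subseteq> cover R \<union> (cover R)\<inverse>"
    and xz: "(x, z) \<in> (L \<union> L\<inverse>)\<^sup>*" and xy: "(x, y) \<in> R" and nE: "(x, y) \<notin> (L \<union> L\<inverse>)\<^sup>*"
  shows "(z, y) \<in> R"
  using xz
proof (induction rule: rtrancl_induct)
  case base
  show ?case by (rule xy)
next
  case (step u v)
  note RD = linear_ordersD[OF R]
  have "(x, v) \<in> (L \<union> L\<inverse>)\<^sup>*"
    using step(1,2) by (rule rtrancl_into_rtrancl)
  then have vy: "v \<noteq> y"
    using nE by auto
  have "(u, v) \<in> cover R \<or> (v, u) \<in> cover R"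
    using step(2) L by auto
  then show ?case
  proof
    assume uv: "(u, v) \<in> cover R"
    then have "v \<in> A" "y \<in> A" "(y, v) \<notin> R"
      using step(3) RD(1) unfolding cover_def by auto
    then show ?thesis
      using RD(4) vy by blast
  next
    assume "(v, u) \<in> cover R"
    then show ?thesis
      using step(3) transD[OF RD(2)] unfolding cover_def by blast
  qed
qed

context
  fixes A :: "'a set" and L R :: "'a rel" and E
  assumes R: "R \<in> linear_orders A" and L: "L \<subseteq> cover R \<union> (cover R)\<inverse>"
  defines "E \<equiv> (L \<union> L\<inverse>)\<^sup>*"
begin

lemma linked_classes_equiv:
  "(x, y) \<in> E \<Longrightarrow> (y, x) \<in> E"
  "(x, y) \<in> E \<Longrightarrow> (y, z) \<in> E \<Longrightarrow> (x, z) \<in> E"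
  unfolding E_def by (erule symD[OF sym_rtrancl[OF sym_Un_converse]]) (rule rtrancl_trans)

text \<open>The second claim is the first for the converse order; the assumption on \<open>L\<close>
  is unchanged because links may run along or against \<open>R\<close>.\<close>

lemma linked_classes_intervals:
  "(x, z) \<in> E \<Longrightarrow> (x, y) \<in> R \<Longrightarrow> (x, y) \<notin> E \<Longrightarrow> (z, y) \<in> R"
  "(x, z) \<in> E \<Longrightarrow> (y, x) \<in> R \<Longrightarrow> (x, y) \<notin> E \<Longrightarrow> (y, z) \<in> R"
  using linked_classes_convex[OF R L, of x z y]
    linked_classes_convex[OF converse_linear_orders[OF R], of L x z y] L
  unfolding E_def cover_converse by auto

text \<open>Only transitivity needs the interval property; the cases record which of the two steps
  stay inside a class.\<close>

lemma reverse_classes_linear_orders: "reverse_classes E R \<in> linear_orders A"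
proof -
  note RD = linear_ordersD[OF R]
  note E = linked_classes_equiv
  have "trans (reverse_classes E R)"
  proof (rule transI)
    fix x y z
    assume *: "(x, y) \<in> reverse_classes E R" "(y, z) \<in> reverse_classes E R"
    consider "(x, y) \<in> E" "(y, z) \<in> E" | "(x, y) \<in> E" "(y, z) \<notin> E"
      | "(x, y) \<notin> E" "(y, z) \<in> E" | "(x, y) \<notin> E" "(y, z) \<notin> E"
      by blast
    then show "(x, z) \<in> reverse_classes E R"
    proof cases
      case 1
      then show ?thesis
        using * E(2)[OF 1] transD[OF RD(2), of z y x] unfolding reverse_classes_def by auto
    next
      case 2
      then have "(y, x) \<in> E" "(x, z) \<notin> E"
        using E(1)[of x y] E(1)[of y z] E(1)[of y x] E(2)[of y x z] E(2)[of x z y] by blast+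
      then show ?thesis
        using * 2 linked_classes_intervals(1)[of y x z] unfolding reverse_classes_def by auto
    next
      case 3
      then have "(y, x) \<notin> E" "(x, z) \<notin> E"
        using E(1)[of x y] E(1)[of y z] E(1)[of y x] E(2)[of y x z] E(2)[of x z y] by blast+
      then show ?thesis
        using * 3 linked_classes_intervals(2)[of y z x] unfolding reverse_classes_def by auto
    next
      case 4
      then have xy: "(x, y) \<in> R" and yz: "(y, z) \<in> R"
        using * unfolding reverse_classes_def by auto
      then have xz: "(x, z) \<in> R"
        by (rule transD[OF RD(2)])
      \<comment> \<open>If \<open>x\<close> and \<open>z\<close> shared a class, \<open>y\<close>
        outside it and after \<open>x\<close> would also come after \<open>z\<close>, against
        \<open>yz\<close>.\<close>
      have "(x, z) \<notin> E"
        using linked_classes_intervals(1)[of x z y] 4 xy transD[OF RD(2) yz, of y] RD(3) by blast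
      then show ?thesis
        using xz unfolding reverse_classes_def by auto
    qed
  qed
  moreover have "reverse_classes E R \<subseteq> A \<times> A"
    using RD(1) unfolding reverse_classes_def by auto
  moreover have "irrefl (reverse_classes E R)"
    using RD(3) unfolding reverse_classes_def irrefl_def by auto
  moreover have "total_on A (reverse_classes E R)"
    using RD(4) E(1) unfolding reverse_classes_def total_on_def by blast
  ultimately show ?thesis
    unfolding linear_orders_def strict_linear_order_on_def by auto
qed

text \<open>An element \<open>u\<close> newly between \<open>y\<close> and \<open>x\<close> would,
  inside the class, already have separated \<open>x\<close> from \<open>y\<close>; outside it, its
  comparisons are unchanged and close a cycle in \<open>R\<close>.\<close>

lemma cover_reverse_classes:
  assumes "(x, y) \<in> E" "(x, y) \<in> cover R"
  shows "(y, x) \<in> cover (reverse_classes E R)"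
proof -
  note RD = linear_ordersD[OF R]
  note E = linked_classes_equiv
  have xy: "(x, y) \<in> R" "(y, x) \<in> E"
    using assms E(1) unfolding cover_def by auto
  have False if u: "(y, u) \<in> reverse_classes E R" "(u, x) \<in> reverse_classes E R" for u
  proof (cases "(y, u) \<in> E")
    case True
    then have "(u, x) \<in> E"
      using xy(2) E(1)[of y u] E(2)[of u y x] by blast
    then show False
      using True u assms(2) unfolding reverse_classes_def cover_def by auto
  next
    case False
    then have "(u, x) \<notin> E"
      using xy(2) E(1)[of u x] E(2)[of y x u] by blast
    then show False
      using False u xy transD[OF RD(2), of x y u] transD[OF RD(2), of x u x] RD(3)
      unfolding reverse_classes_def by blast
  qed
  then show ?thesis
    using xy unfolding cover_def reverse_classes_def by auto
qed

end

text \<open>A class is a chain for \<open>L\<close>, so none of its elements lies strictly between \<open>x\<close> and its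
  \<open>L\<close>-successor.\<close>
lemma not_linked_if_between:
  fixes L :: "'a::order rel"
  assumes sv: "single_valued L" "single_valued (L\<inverse>)"
    and less: "\<And>a b. (a, b) \<in> L \<Longrightarrow> a < b"
    and xv: "(x, v) \<in> L" and xyv: "x < y" "y < v"
  shows "(x, y) \<notin> (L \<union> L\<inverse>)\<^sup>*"
proof
  assume "(x, y) \<in> (L \<union> L\<inverse>)\<^sup>*"
  \<comment> \<open>With at most one successor and one predecessor each, elements of one class are
    comparable along \<open>L\<close>; the two turning cases use confluence.\<close>
  then have chain: "(x, y) \<in> L\<^sup>* \<or> (y, x) \<in> L\<^sup>*"
  proof (induction rule: rtrancl_induct)
    case (step u w)
    then consider "(x, u) \<in> L\<^sup>*" "(u, w) \<in> L" | "(u, x) \<in> L\<^sup>*" "(w, u) \<in> L"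
      | "(u, x) \<in> L\<^sup>*" "(u, w) \<in> L" | "(x, u) \<in> L\<^sup>*" "(w, u) \<in> L"
      by blast
    then show ?case
    proof cases
      case 3
      then show ?thesis
        using single_valued_confluent[OF sv(1)] by (meson r_into_rtrancl)
    next
      case 4
      then have "(u, x) \<in> (L\<inverse>)\<^sup>*" "(u, w) \<in> (L\<inverse>)\<^sup>*"
        by (auto simp: rtrancl_converse)
      then show ?thesis
        using single_valued_confluent[OF sv(2)] by (auto simp: rtrancl_converse)
    qed (meson rtrancl.rtrancl_into_rtrancl converse_rtrancl_into_rtrancl)+
  qed auto
  have le: "a \<le> b" if "(a, b) \<in> L\<^sup>*" for a b
    using that by (induction rule: rtrancl_induct) (auto dest: less)
  have "(x, y) \<in> L\<^sup>*"
    using chain le xyv by fastforce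
  then obtain u where "(x, u) \<in> L" "(u, y) \<in> L\<^sup>*"
    using xyv by (auto elim: converse_rtranclE)
  \<comment> \<open>Single-valuedness forces \<open>u = v\<close>, but a path from \<open>v\<close>
    cannot descend to \<open>y < v\<close>.\<close>
  then show False
    using sv(1) xv xyv le[of u y] unfolding single_valued_def by fastforce
qed

section \<open>Reversing links while keeping precedences\<close>

text \<open>\<open>L\<close> holds the adjacencies and \<open>B\<close> the precedences. The
  converse of \<open>B\<close> is included because the smaller of two compared letters may come
  second. The condition survives unions, so it can be checked one occurrence at a time.\<close>

definition crossing :: "'a::linorder rel \<Rightarrow> 'a rel \<Rightarrow> bool" where
  "crossing L B \<longleftrightarrow> (\<forall>x y. (x, y) \<in> L \<longrightarrow> x < y) \<and>
     (\<forall>x y. (x, y) \<in> B \<union> B\<inverse> \<longrightarrow> x < y \<longrightarrow> (\<exists>v. (x, v) \<in> L \<and> y < v))"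

text \<open>Pairs in \<open>B\<close> join different classes, hence are not flipped. Both directions
  of \<open>L\<close> are treated together so that one map also serves as its own inverse.\<close>

lemma reverse_linked_classes:
  assumes fixed: "crossing L B" and R: "R \<in> linear_orders A" and BR: "B \<subseteq> R"
    and L: "L \<subseteq> cover R \<or> L\<inverse> \<subseteq> cover R"
  defines "R' \<equiv> reverse_classes ((L \<union> L\<inverse>)\<^sup>*) R"
  shows "R' \<in> linear_orders A" "B \<subseteq> R'"
    "L \<subseteq> cover R \<Longrightarrow> L\<inverse> \<subseteq> cover R'" "L\<inverse> \<subseteq> cover R \<Longrightarrow> L \<subseteq> cover R'"
proof -
  let ?E = "(L \<union> L\<inverse>)\<^sup>*"
  have L': "L \<subseteq> cover R \<union> (cover R)\<inverse>"
    using L by auto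
  have LE: "L \<union> L\<inverse> \<subseteq> ?E"
    by auto
  show "R' \<in> linear_orders A"
    unfolding R'_def by (rule reverse_classes_linear_orders[OF R L'])
  show "L\<inverse> \<subseteq> cover R'" if "L \<subseteq> cover R"
    unfolding R'_def using cover_reverse_classes[OF R L'] that LE by auto
  show "L \<subseteq> cover R'" if "L\<inverse> \<subseteq> cover R"
    unfolding R'_def using cover_reverse_classes[OF R L'] that LE by auto
  have "single_valued (cover R)" "single_valued ((cover R)\<inverse>)"
    using single_valued_cover[OF R] single_valued_cover[OF converse_linear_orders[OF R]]
    by (simp_all add: cover_converse)
  \<comment> \<open>Inherited from the covering relation, where every element has at most one
    neighbour on each side.\<close>
  then have sv: "single_valued L" "single_valued (L\<inverse>)"
    using L unfolding single_valued_def by blast+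
  have less: "a < b" if "(a, b) \<in> L" for a b
    using fixed that unfolding crossing_def by auto
  have symE: "sym ?E"
    by (rule sym_rtrancl[OF sym_Un_converse])
  have sep: "(x, y) \<notin> ?E" if xy: "(x, y) \<in> B \<union> B\<inverse>" "x < y" for x y
  proof -
    obtain v where "(x, v) \<in> L" "y < v"
      using fixed xy unfolding crossing_def by meson
    then show ?thesis
      using not_linked_if_between[OF sv less] xy(2) by blast
  qed
  have "(x, y) \<notin> ?E" if xy: "(x, y) \<in> B" for x y
  proof -
    have "x < y \<or> y < x"
      using BR xy linear_ordersD(3)[OF R] by (metis neqE subsetD)
    then show ?thesis
      using sep[of x y] sep[of y x] xy symD[OF symE, of x y] by auto
  qed
  then show "B \<subseteq> R'"
    unfolding R'_def reverse_classes_def using BR by auto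
qed

text \<open>The classes depend on \<open>L\<close> alone, so the same involution maps each of the
  two sets into the other.\<close>

lemma card_linear_orders_reverse_links:
  assumes LB: "crossing L B"
  shows "card {R \<in> linear_orders A. L \<subseteq> cover R \<and> B \<subseteq> R} =
         card {R \<in> linear_orders A. L\<inverse> \<subseteq> cover R \<and> B \<subseteq> R}"
proof (rule bij_betw_same_card)
  let ?f = "reverse_classes ((L \<union> L\<inverse>)\<^sup>*)"
  have invol: "?f (?f R) = R" for R
    by (rule reverse_classes_invol[OF sym_rtrancl[OF sym_Un_converse]])
  let ?X = "{R \<in> linear_orders A. L \<subseteq> cover R \<and> B \<subseteq> R}"
    and ?Y = "{R \<in> linear_orders A. L\<inverse> \<subseteq> cover R \<and> B \<subseteq> R}"
  have "?f R \<in> ?Y" if "R \<in> ?X" for R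
    using reverse_linked_classes[OF LB, of R A] that by simp
  moreover have "?f R \<in> ?X" if "R \<in> ?Y" for R
    using reverse_linked_classes[OF LB, of R A] that by simp
  ultimately show "bij_betw ?f ?X ?Y"
    by (intro bij_betw_byWitness[where f' = ?f] ballI invol image_subsetI) blast+
qed

text \<open>Each \<open>T\<close> is a potential occurrence with adjacencies \<open>lk T\<close> and
  precedences \<open>pr T\<close>. Containing a whole marked set \<open>S\<close> amounts to meeting
  the union of its conditions, which is again \<open>crossing\<close>.\<close>

lemma card_linear_orders_occurrences_reverse:
  fixes lk pr :: "'t \<Rightarrow> 'a::linorder rel"
  assumes fin: "finite A" "finite U" and T: "\<And>T. T \<in> U \<Longrightarrow> crossing (lk T) (pr T)"
  shows "card {R \<in> linear_orders A. card {T \<in> U. lk T \<subseteq> cover R \<and> pr T \<subseteq> R} = k} =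
         card {R \<in> linear_orders A. card {T \<in> U. (lk T)\<inverse> \<subseteq> cover R \<and> pr T \<subseteq> R} = k}"
proof (rule card_eq_if_marked_card_eq[OF finite_linear_orders[OF fin(1)] fin(2)])
  fix S assume S: "S \<subseteq> U"
  let ?L = "\<Union>(lk ` S)" and ?B = "\<Union>(pr ` S)"
  have "\<exists>v. (x, v) \<in> ?L \<and> y < v" if xy: "(x, y) \<in> ?B \<union> ?B\<inverse>" "x < y" for x y
  proof -
    obtain T where "T \<in> S" "(x, y) \<in> pr T \<union> (pr T)\<inverse>"
      using xy by auto
    moreover from this obtain v where "(x, v) \<in> lk T" "y < v"
      using T S xy(2) unfolding crossing_def by (meson subsetD)
    ultimately show ?thesis
      by blast
  qed
  moreover have "x < y" if "(x, y) \<in> ?L" for x y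
    using that T S unfolding crossing_def by auto
  ultimately have "crossing ?L ?B"
    unfolding crossing_def by blast
  note card = card_linear_orders_reverse_links[OF this]
  have "{R \<in> linear_orders A. S \<subseteq> {T \<in> U. lk T \<subseteq> cover R \<and> pr T \<subseteq> R}} =
      {R \<in> linear_orders A. ?L \<subseteq> cover R \<and> ?B \<subseteq> R}"
    using S by auto
  moreover have "{R \<in> linear_orders A. S \<subseteq> {T \<in> U. (lk T)\<inverse> \<subseteq> cover R \<and> pr T \<subseteq> R}} =
      {R \<in> linear_orders A. ?L\<inverse> \<subseteq> cover R \<and> ?B \<subseteq> R}"
    using S by auto
  ultimately show "card {R \<in> linear_orders A. S \<subseteq> {T \<in> U. lk T \<subseteq> cover R \<and> pr T \<subseteq> R}} =
      card {R \<in> linear_orders A. S \<subseteq> {T \<in> U. (lk T)\<inverse> \<subseteq> cover R \<and> pr T \<subseteq> R}}"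
    using card by simp
qed auto

section \<open>Permutations as linear orders on their values\<close>

definition word_order :: "nat \<Rightarrow> (nat \<Rightarrow> nat) \<Rightarrow> nat rel" where
  "word_order n \<sigma> = {(x, y). x \<in> {1..n} \<and> y \<in> {1..n} \<and> inv \<sigma> x < inv \<sigma> y}"

text \<open>Recovers positions from the order, whence the injectivity of
  \<open>word_order n\<close>.\<close>

lemma inv_eq_card_word_order:
  assumes p: "\<sigma> permutes {1..n}" and x: "x \<in> {1..n}"
  shows "inv \<sigma> x = Suc (card {z. (z, x) \<in> word_order n \<sigma>})"
proof -
  note q = permutes_inv[OF p]
  have ix: "inv \<sigma> x \<in> {1..n}"
    using x permutes_in_image[OF q] by blast
  have "{z. (z, x) \<in> word_order n \<sigma>} = \<sigma> ` {1..<inv \<sigma> x}"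
  proof (intro equalityI subsetI)
    fix z assume z: "z \<in> {z. (z, x) \<in> word_order n \<sigma>}"
    then have "inv \<sigma> z \<in> {1..n}"
      using permutes_in_image[OF q, of z] by (simp add: word_order_def)
    then have "inv \<sigma> z \<in> {1..<inv \<sigma> x}"
      using z by (simp add: word_order_def)
    then show "z \<in> \<sigma> ` {1..<inv \<sigma> x}"
      by (rule image_eqI[where x = "inv \<sigma> z", rotated]) (simp add: permutes_inverses(1)[OF p])
  next
    fix z assume "z \<in> \<sigma> ` {1..<inv \<sigma> x}"
    then obtain i where i: "i \<in> {1..<inv \<sigma> x}" "z = \<sigma> i"
      by blast
    then have "i \<in> {1..n}"
      using ix by simp
    then have "\<sigma> i \<in> {1..n}"
      using permutes_in_image[OF p] by blast
    then show "z \<in> {z. (z, x) \<in> word_order n \<sigma>}"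
      using i x by (simp add: word_order_def permutes_inverses[OF p])
  qed
  then have "card {z. (z, x) \<in> word_order n \<sigma>} = inv \<sigma> x - 1"
    using card_image[OF inj_on_subset[OF permutes_inj[OF p] subset_UNIV], of "{1..<inv \<sigma> x}"]
    by simp
  then show ?thesis
    using ix by simp
qed

lemma word_order_in_linear_orders:
  assumes p: "\<sigma> permutes {1..n}"
  shows "word_order n \<sigma> \<in> linear_orders {1..n}"
proof -
  have "inv \<sigma> x \<noteq> inv \<sigma> y" if "x \<noteq> y" for x y
    using that inj_eq[OF permutes_inj[OF permutes_inv[OF p]]] by simp
  then have "total_on {1..n} (word_order n \<sigma>)"
    unfolding total_on_def word_order_def by (simp add: nat_neq_iff)
  moreover have "trans (word_order n \<sigma>)" "irrefl (word_order n \<sigma>)"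
    unfolding trans_def irrefl_def word_order_def by simp_all
  moreover have "word_order n \<sigma> \<subseteq> {1..n} \<times> {1..n}"
    unfolding word_order_def by blast
  ultimately show ?thesis
    unfolding linear_orders_def strict_linear_order_on_def by simp
qed

lemma word_order_surj:
  assumes R: "R \<in> linear_orders {1..n}"
  obtains \<sigma> where "\<sigma> permutes {1..n}" "word_order n \<sigma> = R"
proof -
  note RD = linear_ordersD[OF R]
  \<comment> \<open>The position of \<open>x\<close> in the word sought, so the permutation will be
    \<open>inv pos\<close>; outside \<open>{1..n}\<close> it is the identity, as
    \<open>permutes\<close> demands.\<close>
  define pos where "pos x = (if x \<in> {1..n} then Suc (card {z. (z, x) \<in> R}) else x)" for x
  have fin: "finite {z. (z, x) \<in> R}" for x
    by (rule finite_subset[of _ "{1..n}"]) (use RD(1) in auto)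
  have mono: "pos x < pos y" if xy: "(x, y) \<in> R" for x y
  proof -
    have "{z. (z, x) \<in> R} \<subset> {z. (z, y) \<in> R}"
      using xy transD[OF RD(2) _ xy] RD(3)[of x] by blast
    moreover have "x \<in> {1..n}" "y \<in> {1..n}"
      using xy RD(1) by blast+
    ultimately show ?thesis
      using psubset_card_mono[OF fin] unfolding pos_def by simp
  qed
  have bound: "pos x \<in> {1..n}" if x: "x \<in> {1..n}" for x
  proof -
    have "{z. (z, x) \<in> R} \<subset> {1..n}"
      using RD(1) RD(3)[of x] x by blast
    then have "card {z. (z, x) \<in> R} < card {1..n}"
      by (rule psubset_card_mono[OF finite_atLeastAtMost])
    then show ?thesis
      using x unfolding pos_def by simp
  qed
  have inj: "inj_on pos {1..n}"
  proof (rule inj_onI, rule ccontr)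
    fix x y assume "x \<in> {1..n}" "y \<in> {1..n}" "pos x = pos y" "x \<noteq> y"
    then show False
      using RD(4)[of x y] mono[of x y] mono[of y x] by auto
  qed
  have "pos ` {1..n} = {1..n}"
    by (rule endo_inj_surj[OF finite_atLeastAtMost _ inj]) (use bound in blast)
  then have perm: "pos permutes {1..n}"
    using inj by (intro bij_imp_permutes) (auto simp: bij_betw_def, auto simp: pos_def)
  have "(x, y) \<in> word_order n (inv pos) \<longleftrightarrow> (x, y) \<in> R" for x y
  proof -
    have "(x, y) \<in> word_order n (inv pos) \<longleftrightarrow> x \<in> {1..n} \<and> y \<in> {1..n} \<and> pos x < pos y"
      unfolding word_order_def permutes_inv_inv[OF perm] by simp
    also have "\<dots> \<longleftrightarrow> (x, y) \<in> R"
      using RD(1) RD(4)[of x y] mono[of x y] mono[of y x] by (cases "x = y") auto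
    finally show ?thesis .
  qed
  then have "word_order n (inv pos) = R"
    by (auto simp: set_eq_iff)
  then show thesis
    using that permutes_inv[OF perm] by blast
qed

lemma bij_betw_word_order:
  "bij_betw (word_order n) {\<sigma>. \<sigma> permutes {1..n}} (linear_orders {1..n})"
  unfolding bij_betw_def
proof (intro conjI inj_onI equalityI subsetI)
  fix \<sigma> \<tau>
  assume "\<sigma> \<in> {\<sigma>. \<sigma> permutes {1..n}}" "\<tau> \<in> {\<sigma>. \<sigma> permutes {1..n}}"
    and eq: "word_order n \<sigma> = word_order n \<tau>"
  then have p: "\<sigma> permutes {1..n}" "\<tau> permutes {1..n}"
    by auto
  have "inv \<sigma> x = inv \<tau> x" for x
  proof (cases "x \<in> {1..n}")
    case True
    then show ?thesis
      by (simp only: inv_eq_card_word_order[OF p(1)] inv_eq_card_word_order[OF p(2)] eq)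
  next
    case False
    then show ?thesis
      using p[THEN permutes_inv, THEN permutes_not_in] by metis
  qed
  then have "inv (inv \<sigma>) = inv (inv \<tau>)"
    by presburger
  then show "\<sigma> = \<tau>"
    by (simp only: permutes_inv_inv[OF p(1)] permutes_inv_inv[OF p(2)])
next
  fix R assume "R \<in> word_order n ` {\<sigma>. \<sigma> permutes {1..n}}"
  then show "R \<in> linear_orders {1..n}"
    using word_order_in_linear_orders by blast
next
  fix R assume "R \<in> linear_orders {1..n}"
  then show "R \<in> word_order n ` {\<sigma>. \<sigma> permutes {1..n}}"
    by (rule word_order_surj) blast
qed

section \<open>Occurrences in terms of values\<close>

definition value_occurrence :: "dashed_pattern \<Rightarrow> nat \<Rightarrow> nat rel \<Rightarrow> nat list \<Rightarrow> bool" where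
  "value_occurrence p n R u \<longleftrightarrow>
     length u = length (letters p) \<and> sorted_wrt (\<lambda>x y. (x, y) \<in> R) u \<and> set u \<subseteq> {1..n} \<and>
     (\<forall>s<length u. \<forall>t<length u. u ! s > u ! t \<longleftrightarrow> letters p ! s > letters p ! t) \<and>
     (\<forall>s. Suc s < length u \<longrightarrow> Suc s \<notin> dashes p \<longrightarrow> (u ! s, u ! Suc s) \<in> cover R)"

text \<open>Sending a position to its letter is an order isomorphism onto the values under
  \<open>word_order\<close>; it turns consecutive positions into covering pairs.\<close>

lemma occurrences_perm_word:
  assumes p: "\<sigma> permutes {1..n}"
  shows "occurrences P (perm_word n \<sigma>) = card {u. value_occurrence P n (word_order n \<sigma>) u}"
proof -
  \<comment> \<open>List indices start at 0, arguments of the permutation at 1.\<close>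
  let ?R = "word_order n \<sigma>" and ?f = "\<lambda>i. \<sigma> (Suc i)"
  have fA: "?f i \<in> {1..n} \<longleftrightarrow> i < n" for i
    using permutes_in_image[OF p, of "Suc i"] by auto
  have fR: "(?f i, ?f j) \<in> ?R \<longleftrightarrow> i < j" if "i < n" "j < n" for i j
    using fA[of i] fA[of j] that permutes_inverses[OF p] by (auto simp: word_order_def)
  have surj: "\<exists>i<n. x = ?f i" if x: "x \<in> {1..n}" for x
  proof -
    have "inv \<sigma> x \<in> {1..n}"
      using x permutes_in_image[OF permutes_inv[OF p]] by blast
    then show ?thesis
      using permutes_inverses[OF p]
      by (intro exI[of _ "inv \<sigma> x - 1"]) auto
  qed
  have fcover: "(?f i, ?f j) \<in> cover ?R \<longleftrightarrow> j = Suc i" if ij: "i < n" "j < n" for i j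
  proof -
    have "(?f i, ?f j) \<in> ?R O ?R \<longleftrightarrow> (\<exists>k<n. i < k \<and> k < j)"
    proof
      assume "(?f i, ?f j) \<in> ?R O ?R"
      then obtain x where x: "(?f i, x) \<in> ?R" "(x, ?f j) \<in> ?R"
        by auto
      then have "x \<in> {1..n}"
        by (auto simp: word_order_def)
      then show "\<exists>k<n. i < k \<and> k < j"
        using surj x fR ij by metis
    qed (use fR ij in blast)
    then show ?thesis
      using fR[OF ij] ij unfolding cover_def by (auto intro: Suc_lessI)
  qed
  have iff: "is_occurrence P (perm_word n \<sigma>) i \<longleftrightarrow> value_occurrence P n ?R (map ?f i)"
    if i: "set i \<subseteq> {..<n}" for i
  proof -
    have in': "i ! s < n" if "s < length i" for s
      using i that nth_mem by blast
    have nth: "perm_word n \<sigma> ! (i ! s) = ?f (i ! s)" if "s < length i" for s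
      using in'[OF that] by (simp add: perm_word_def del: upt_Suc)
    have "sorted_wrt (\<lambda>x y. (x, y) \<in> ?R) (map ?f i) \<longleftrightarrow> sorted_wrt (<) i"
      using fR in' by (auto simp: sorted_wrt_iff_nth_less)
    moreover have "length (perm_word n \<sigma>) = n"
      by (simp add: perm_word_def)
    moreover have "set (map ?f i) \<subseteq> {1..n}"
      using i fA by auto
    ultimately show ?thesis
      using i in' fcover nth unfolding is_occurrence_def value_occurrence_def
      by (auto simp del: upt_Suc)
  qed
  have "{u. value_occurrence P n ?R u} = map ?f ` {i. is_occurrence P (perm_word n \<sigma>) i}"
  proof (intro equalityI subsetI)
    fix u assume "u \<in> {u. value_occurrence P n ?R u}"
    then have u: "value_occurrence P n ?R u"
      by simp
    then have "\<forall>x\<in>set u. \<exists>i<n. x = ?f i"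
      using surj unfolding value_occurrence_def by blast
    then obtain g where g: "\<And>x. x \<in> set u \<Longrightarrow> g x < n \<and> x = ?f (g x)"
      by metis
    then have "map ?f (map g u) = u"
      by (auto simp: list_eq_iff_nth_eq)
    moreover have "set (map g u) \<subseteq> {..<n}"
      using g by auto
    ultimately show "u \<in> map ?f ` {i. is_occurrence P (perm_word n \<sigma>) i}"
      using iff u by (metis image_eqI mem_Collect_eq)
  next
    fix u assume "u \<in> map ?f ` {i. is_occurrence P (perm_word n \<sigma>) i}"
    then obtain i where "u = map ?f i" "is_occurrence P (perm_word n \<sigma>) i"
      by auto
    moreover from this have "set i \<subseteq> {..<n}"
      by (simp add: is_occurrence_def perm_word_def del: upt_Suc)
    ultimately show "u \<in> {u. value_occurrence P n ?R u}"
      using iff by simp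
  qed
  moreover have "inj (map ?f)"
    using permutes_inj[OF p] by (intro inj_mapI) (auto simp: inj_def)
  ultimately show ?thesis
    unfolding occurrences_def by (metis card_image inj_on_subset subset_UNIV)
qed

lemma card_occurrences_eq_linear_orders:
  "card {\<sigma>. \<sigma> permutes {1..n} \<and> occurrences P (perm_word n \<sigma>) = k} =
   card {R \<in> linear_orders {1..n}. card {u. value_occurrence P n R u} = k}"
proof (rule bij_betw_same_card)
  let ?X = "{\<sigma>. \<sigma> permutes {1..n} \<and> occurrences P (perm_word n \<sigma>) = k}"
  have "bij_betw (word_order n) ?X (word_order n ` ?X)"
    by (rule bij_betw_subset[OF bij_betw_word_order]) auto
  moreover have "word_order n ` ?X =
      {R \<in> linear_orders {1..n}. card {u. value_occurrence P n R u} = k}"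
    unfolding bij_betw_imp_surj_on[OF bij_betw_word_order[of n], symmetric]
    using occurrences_perm_word by auto
  ultimately show "bij_betw (word_order n) ?X
      {R \<in> linear_orders {1..n}. card {u. value_occurrence P n R u} = k}"
    by simp
qed

section \<open>Patterns with four distinct letters\<close>

definition quads :: "nat \<Rightarrow> (nat \<times> nat \<times> nat \<times> nat) set" where
  "quads n = {(a, b, c, d). 1 \<le> a \<and> a < b \<and> b < c \<and> c < d \<and> d \<le> n}"

lemma finite_quads: "finite (quads n)"
  by (rule finite_subset[of _ "{1..n} \<times> {1..n} \<times> {1..n} \<times> {1..n}"]) (auto simp: quads_def)

text \<open>Here \<open>f\<close> arranges four increasing values in the shape of the pattern, and
  \<open>\<Phi>\<close> collects the conditions on their places in the word.\<close>

lemma card_occurrences_eq_quads: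
  assumes f: "inj f"
    and occ: "\<And>R. R \<in> linear_orders {1..n} \<Longrightarrow>
      {u. value_occurrence P n R u} = f ` {T \<in> quads n. \<Phi> R T}"
  shows "card {\<sigma>. \<sigma> permutes {1..n} \<and> occurrences P (perm_word n \<sigma>) = k} =
    card {R \<in> linear_orders {1..n}. card {T \<in> quads n. \<Phi> R T} = k}"
proof -
  have "card {u. value_occurrence P n R u} = card {T \<in> quads n. \<Phi> R T}"
    if "R \<in> linear_orders {1..n}" for R
    unfolding occ[OF that] by (rule card_image[OF inj_on_subset[OF f subset_UNIV]])
  then show ?thesis
    unfolding card_occurrences_eq_linear_orders by (metis (mono_tags, lifting))
qed

text \<open>Reading words backwards permutes the linear orders.\<close>

lemma card_linear_orders_occurrences_converse:
  "card {R \<in> linear_orders A. card {T \<in> U. lk T \<subseteq> cover (R\<inverse>) \<and> pr T \<subseteq> R\<inverse>} = k} =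
    card {R \<in> linear_orders A. card {T \<in> U. lk T \<subseteq> cover R \<and> pr T \<subseteq> R} = k}"
  (is "card ?X = card ?Y")
proof (rule bij_betw_same_card)
  show "bij_betw converse ?X ?Y"
    by (rule bij_betw_byWitness[where f' = converse]) (auto intro: converse_linear_orders)
qed

text \<open>Allows a precedence after an adjacent pair to be stated at either of its letters, so
  that two patterns can share the same \<open>pr\<close>.\<close>

lemma cover_above:
  assumes R: "R \<in> linear_orders A" and "(x, y) \<in> cover R" "(x, z) \<in> R" "z \<noteq> y"
  shows "(y, z) \<in> R"
proof -
  have "y \<in> A" "z \<in> A" "(z, y) \<notin> R"
    using assms linear_ordersD(1)[OF R] unfolding cover_def by auto
  then show ?thesis
    using linear_ordersD(4)[OF R] assms(4) by blast
qed

lemma cover_below: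
  assumes R: "R \<in> linear_orders A" and "(x, y) \<in> cover R" "(z, y) \<in> R" "z \<noteq> x"
  shows "(z, x) \<in> R"
  using cover_above[OF converse_linear_orders[OF R], of y x z] assms
  by (simp add: cover_converse)

lemma coverD: "(x, y) \<in> cover R \<Longrightarrow> (x, y) \<in> R"
  unfolding cover_def by simp

lemma value_occurrence_4:
  "{u. value_occurrence (DP [p\<^sub>0, p\<^sub>1, p\<^sub>2, p\<^sub>3] D) n R u} =
    {[x\<^sub>0, x\<^sub>1, x\<^sub>2, x\<^sub>3] | x\<^sub>0 x\<^sub>1 x\<^sub>2 x\<^sub>3.
      value_occurrence (DP [p\<^sub>0, p\<^sub>1, p\<^sub>2, p\<^sub>3] D) n R [x\<^sub>0, x\<^sub>1, x\<^sub>2, x\<^sub>3]}"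
  unfolding value_occurrence_def by (auto simp: length_Suc_conv)

lemma value_occurrence_4_iff:
  "value_occurrence (DP [p\<^sub>0, p\<^sub>1, p\<^sub>2, p\<^sub>3] D) n R [x\<^sub>0, x\<^sub>1, x\<^sub>2, x\<^sub>3] \<longleftrightarrow>
    {(x\<^sub>0, x\<^sub>1), (x\<^sub>0, x\<^sub>2), (x\<^sub>0, x\<^sub>3), (x\<^sub>1, x\<^sub>2), (x\<^sub>1, x\<^sub>3), (x\<^sub>2, x\<^sub>3)} \<subseteq> R \<and>
    {x\<^sub>0, x\<^sub>1, x\<^sub>2, x\<^sub>3} \<subseteq> {1..n} \<and>
    (\<forall>(x, p) \<in> {(x\<^sub>0, p\<^sub>0), (x\<^sub>1, p\<^sub>1), (x\<^sub>2, p\<^sub>2), (x\<^sub>3, p\<^sub>3)}.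
      \<forall>(y, q) \<in> {(x\<^sub>0, p\<^sub>0), (x\<^sub>1, p\<^sub>1), (x\<^sub>2, p\<^sub>2), (x\<^sub>3, p\<^sub>3)}. x > y \<longleftrightarrow> p > q) \<and>
    (1 \<notin> D \<longrightarrow> (x\<^sub>0, x\<^sub>1) \<in> cover R) \<and> (2 \<notin> D \<longrightarrow> (x\<^sub>1, x\<^sub>2) \<in> cover R) \<and>
    (3 \<notin> D \<longrightarrow> (x\<^sub>2, x\<^sub>3) \<in> cover R)"
  unfolding value_occurrence_def
  by (simp add: All_less_Suc numeral_2_eq_2 numeral_3_eq_3,
      (rule iffI; elim conjE; intro conjI; assumption))

section \<open>Links and precedences of the six patterns\<close>

context
  fixes n :: nat and R :: "nat rel"
  assumes R: "R \<in> linear_orders {1..n}"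
begin

text \<open>Since \<open>b\<close> and \<open>d\<close> are adjacent, \<open>d\<close> before
  \<open>c\<close> may be replaced by \<open>b\<close> before \<open>c\<close>, and \<open>c\<close>
  lies between \<open>b\<close> and its neighbour \<open>d\<close>.\<close>

lemma value_occurrences_124_3:
  "{u. value_occurrence (DP [1,2,4,3] {3}) n R u} = (\<lambda>(a, b, c, d). [a, b, d, c]) `
    {T \<in> quads n. (case T of (a, b, c, d) \<Rightarrow> {(a, b), (b, d)}) \<subseteq> cover R \<and>
      (case T of (a, b, c, d) \<Rightarrow> {(b, c)}) \<subseteq> R}"
proof -
  have "value_occurrence (DP [1,2,4,3] {3}) n R [a, b, d, c] \<longleftrightarrow>
      (a, b, c, d) \<in> quads n \<and> {(a, b), (b, d)} \<subseteq> cover R \<and> {(b, c)} \<subseteq> R" for a b c d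
    unfolding value_occurrence_4_iff quads_def cover_converse
    using cover_above[OF R, of b d c]
      transD[OF linear_ordersD(2)[OF R], of a b d]
      transD[OF linear_ordersD(2)[OF R], of a b c]
    by (auto dest: coverD)
  then show ?thesis
    unfolding value_occurrence_4 by (auto simp: image_iff)
qed

text \<open>Now \<open>b\<close> and \<open>a\<close> are adjacent, so \<open>a\<close> before
  \<open>c\<close> again becomes \<open>b\<close> before \<open>c\<close>.\<close>

lemma value_occurrences_421_3:
  "{u. value_occurrence (DP [4,2,1,3] {3}) n R u} = (\<lambda>(a, b, c, d). [d, b, a, c]) `
    {T \<in> quads n. (case T of (a, b, c, d) \<Rightarrow> {(a, b), (b, d)})\<inverse> \<subseteq> cover R \<and>
      (case T of (a, b, c, d) \<Rightarrow> {(b, c)}) \<subseteq> R}"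
proof -
  have "value_occurrence (DP [4,2,1,3] {3}) n R [d, b, a, c] \<longleftrightarrow>
      (a, b, c, d) \<in> quads n \<and> {(a, b), (b, d)}\<inverse> \<subseteq> cover R \<and> {(b, c)} \<subseteq> R" for a b c d
    unfolding value_occurrence_4_iff quads_def cover_converse
    using cover_above[OF R, of b a c]
      transD[OF linear_ordersD(2)[OF R], of d b a]
      transD[OF linear_ordersD(2)[OF R], of d b c]
    by (auto dest: coverD)
  then show ?thesis
    unfolding value_occurrence_4 by (auto simp: image_iff)
qed

lemma value_occurrences_2_14_3:
  "{u. value_occurrence (DP [2,1,4,3] {1,3}) n R u} = (\<lambda>(a, b, c, d). [b, a, d, c]) `
    {T \<in> quads n. (case T of (a, b, c, d) \<Rightarrow> {(a, d)}) \<subseteq> cover R \<and>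
      (case T of (a, b, c, d) \<Rightarrow> {(b, a), (a, c)}) \<subseteq> R}"
proof -
  have "value_occurrence (DP [2,1,4,3] {1,3}) n R [b, a, d, c] \<longleftrightarrow>
      (a, b, c, d) \<in> quads n \<and> {(a, d)} \<subseteq> cover R \<and> {(b, a), (a, c)} \<subseteq> R" for a b c d
    unfolding value_occurrence_4_iff quads_def cover_converse
    using cover_above[OF R, of a d c]
      transD[OF linear_ordersD(2)[OF R], of b a d]
      transD[OF linear_ordersD(2)[OF R], of b a c]
    by (auto dest: coverD)
  then show ?thesis
    unfolding value_occurrence_4 by (auto simp: image_iff)
qed

text \<open>Here the letter preceding the adjacent pair is the one restated: \<open>b\<close> before
  \<open>d\<close> becomes \<open>b\<close> before \<open>a\<close>.\<close>

lemma value_occurrences_2_41_3: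
  "{u. value_occurrence (DP [2,4,1,3] {1,3}) n R u} = (\<lambda>(a, b, c, d). [b, d, a, c]) `
    {T \<in> quads n. (case T of (a, b, c, d) \<Rightarrow> {(a, d)})\<inverse> \<subseteq> cover R \<and>
      (case T of (a, b, c, d) \<Rightarrow> {(b, a), (a, c)}) \<subseteq> R}"
proof -
  have "value_occurrence (DP [2,4,1,3] {1,3}) n R [b, d, a, c] \<longleftrightarrow>
      (a, b, c, d) \<in> quads n \<and> {(a, d)}\<inverse> \<subseteq> cover R \<and> {(b, a), (a, c)} \<subseteq> R" for a b c d
    unfolding value_occurrence_4_iff quads_def cover_converse
    using cover_below[OF R, of d a b]
      transD[OF linear_ordersD(2)[OF R], of b a c]
      transD[OF linear_ordersD(2)[OF R], of d a c]
    by (auto dest: coverD)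
  then show ?thesis
    unfolding value_occurrence_4 by (auto simp: image_iff)
qed

lemma value_occurrences_13_24:
  "{u. value_occurrence (DP [1,3,2,4] {2}) n R u} = (\<lambda>(a, b, c, d). [a, c, b, d]) `
    {T \<in> quads n. (case T of (a, b, c, d) \<Rightarrow> {(a, c), (b, d)}) \<subseteq> cover R \<and>
      (case T of (a, b, c, d) \<Rightarrow> {(a, b)}) \<subseteq> R}"
proof -
  have "value_occurrence (DP [1,3,2,4] {2}) n R [a, c, b, d] \<longleftrightarrow>
      (a, b, c, d) \<in> quads n \<and> {(a, c), (b, d)} \<subseteq> cover R \<and> {(a, b)} \<subseteq> R" for a b c d
    unfolding value_occurrence_4_iff quads_def cover_converse
    using cover_above[OF R, of a c b]
      transD[OF linear_ordersD(2)[OF R], of a b d]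
      transD[OF linear_ordersD(2)[OF R], of c b d]
    by (auto dest: coverD)
  then show ?thesis
    unfolding value_occurrence_4 by (auto simp: image_iff)
qed

text \<open>Stated for the converse order, where the pairs \<open>b d\<close> and \<open>a c\<close>
  turn into adjacent descents and \<open>a\<close> precedes \<open>b\<close>.\<close>

lemma value_occurrences_24_13:
  "{u. value_occurrence (DP [2,4,1,3] {2}) n R u} = (\<lambda>(a, b, c, d). [b, d, a, c]) `
    {T \<in> quads n. (case T of (a, b, c, d) \<Rightarrow> {(a, c), (b, d)})\<inverse> \<subseteq> cover (R\<inverse>) \<and>
      (case T of (a, b, c, d) \<Rightarrow> {(a, b)}) \<subseteq> R\<inverse>}"
proof -
  have "value_occurrence (DP [2,4,1,3] {2}) n R [b, d, a, c] \<longleftrightarrow>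
      (a, b, c, d) \<in> quads n \<and> {(a, c), (b, d)}\<inverse> \<subseteq> cover (R\<inverse>) \<and> {(a, b)} \<subseteq> R\<inverse>" for a b c d
    unfolding value_occurrence_4_iff quads_def cover_converse
    using cover_above[OF R, of b d a]
      transD[OF linear_ordersD(2)[OF R], of b a c]
      transD[OF linear_ordersD(2)[OF R], of d a c]
    by (auto dest: coverD)
  then show ?thesis
    unfolding value_occurrence_4 by (auto simp: image_iff)
qed

end

section \<open>The three equivalences\<close>

lemma is_dashed_pattern_4:
  assumes "set p = {1, 2, 3, 4}" "length p = 4" "D \<subseteq> {1, 2, 3}"
  shows "is_dashed_pattern (DP p D)"
proof -
  have "{1..4} = {1, 2, 3, 4 :: nat}" "{1..<4} = {1, 2, 3 :: nat}"
    by auto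
  then show ?thesis
    using assms unfolding is_dashed_pattern_def by (auto intro!: exI[of _ 4])
qed

theorem corollary1p7:
  shows "DP [1,2,4,3] {3} \<sim>\<^sub>* DP [4,2,1,3] {3} \<and>
         DP [2,1,4,3] {1,3} \<sim>\<^sub>* DP [2,4,1,3] {1,3} \<and>
         DP [1,3,2,4] {2} \<sim>\<^sub>* DP [2,4,1,3] {2}"
proof (intro conjI)
  note reverse = card_linear_orders_occurrences_reverse[OF finite_atLeastAtMost finite_quads]
  have inj: "inj (\<lambda>(a, b, c, d). [a, b, d, c :: nat])" "inj (\<lambda>(a, b, c, d). [d, b, a, c :: nat])"
    "inj (\<lambda>(a, b, c, d). [b, a, d, c :: nat])" "inj (\<lambda>(a, b, c, d). [b, d, a, c :: nat])"
    "inj (\<lambda>(a, b, c, d). [a, c, b, d :: nat])"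
    by (auto simp: inj_def)
  show "DP [1,2,4,3] {3} \<sim>\<^sub>* DP [4,2,1,3] {3}"
    unfolding strongly_wilf_equiv_def
    \<comment> \<open>Both counts become counts of linear orders with opposite links and equal
      precedences; what remains is \<open>crossing\<close> for each quadruple and well-formedness of
      the patterns.\<close>
    by (simp only: card_occurrences_eq_quads[OF inj(1) value_occurrences_124_3]
      card_occurrences_eq_quads[OF inj(2) value_occurrences_421_3],
      intro conjI allI reverse is_dashed_pattern_4) (auto simp: crossing_def quads_def)
  show "DP [2,1,4,3] {1,3} \<sim>\<^sub>* DP [2,4,1,3] {1,3}"
    unfolding strongly_wilf_equiv_def
    by (simp only: card_occurrences_eq_quads[OF inj(3) value_occurrences_2_14_3]
      card_occurrences_eq_quads[OF inj(4) value_occurrences_2_41_3],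
      intro conjI allI reverse is_dashed_pattern_4) (auto simp: crossing_def quads_def)
  text \<open>The descending counterpart of \<open>13-24\<close> is \<open>31-42\<close>, which is \<open>24-13\<close> read backwards.\<close>
  show "DP [1,3,2,4] {2} \<sim>\<^sub>* DP [2,4,1,3] {2}"
    unfolding strongly_wilf_equiv_def
    by (simp only: card_occurrences_eq_quads[OF inj(5) value_occurrences_13_24]
      card_occurrences_eq_quads[OF inj(4) value_occurrences_24_13]
      card_linear_orders_occurrences_converse,
      intro conjI allI reverse is_dashed_pattern_4) (auto simp: crossing_def quads_def)
qed

end
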